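(* Let $(a_j)_{j=0}^\infty$ be independent random variables with $\mathbb E|a_j|\le\gamma<\infty$, and $\liminf_{j}\mathcal L(a_j,\varepsilon)<1$ for some $\varepsilon>0$. Then the random power series $f(z)=\sum_{j=0}^\infty a_jz^j$ almost surely has radius of convergence $1$, and the unit circle is almost surely a natural boundary for $f$.
   Context: Lévy concentration function: for a random variable $\xi$ and $\delta>0$, $\mathcal L(\xi,\delta)=\sup_{t\in\mathbb R}\mathbb P(|\xi-t|<\delta)$. Natural boundary: if the power series $f(z)=\sum_{j=0}^\infty a_jz^j$ has radius of convergence $r_f<\infty$, then the circle $|z|=r_f$ is the natural boundary of $f$ if $f$ cannot be extended to a holomorphic function through any arc of this circle. *)

theory Defs
  imports "HOL-Probability.Probability" "HOL-Complex_Analysis.Complex_Analysis"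
begin

definition levy_concentration :: "'w measure \<Rightarrow> ('w \<Rightarrow> real) \<Rightarrow> real \<Rightarrow> real" where
  "levy_concentration M X \<delta> = (SUP t. measure M {\<omega> \<in> space M. \<bar>X \<omega> - t\<bar> < \<delta>})"

definition circle_arc :: "real \<Rightarrow> real \<Rightarrow> real \<Rightarrow> complex set" where
  "circle_arc r \<alpha> \<beta> = {of_real r * cis \<theta> | \<theta>. \<alpha> < \<theta> \<and> \<theta> < \<beta>}"

text \<open>
  An extension of the power series with coefficients \<open>c\<close> through a subset \<open>A\<close> of the boundary
  of the disc of radius \<open>r\<close>: a function that is holomorphic on the disc together with an open
  neighbourhood of \<open>A\<close> and agrees with the series inside the disc.
\<close>

definition extends_through :: "(nat \<Rightarrow> complex) \<Rightarrow> real \<Rightarrow> complex set \<Rightarrow> bool" where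
  "extends_through c r A \<longleftrightarrow>
     (\<exists>U g. open U \<and> A \<subseteq> U \<and> g holomorphic_on (ball 0 r \<union> U) \<and>
            (\<forall>z\<in>ball 0 r. g z = (\<Sum>j. c j * z ^ j)))"

text \<open>
  \<open>natural_boundary c r\<close>: the circle \<open>sphere 0 r\<close> is the natural boundary of the power series
  with coefficients \<open>c\<close>; in particular \<open>r\<close> has to be its radius of convergence, which is thus
  finite.
\<close>

definition natural_boundary :: "(nat \<Rightarrow> complex) \<Rightarrow> real \<Rightarrow> bool" where
  "natural_boundary c r \<longleftrightarrow>
     conv_radius c = ereal r \<and>
     (\<forall>\<alpha> \<beta>. \<alpha> < \<beta> \<longrightarrow> \<not> extends_through c r (circle_arc r \<alpha> \<beta>))"

end

theory Submission
  imports Defs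
begin

text \<open>
  Continuability of the random series to a fixed disc crossing the unit circle is a tail event, so
  it has probability 0 or 1, and countably many discs suffice. Suppose the probability is 1 for some
  disc. Take \<open>m\<close> large compared with the size of the disc, and replace the coefficients in one
  residue class modulo \<open>m\<close> by an independent copy: the law of the series is unchanged, so both
  series are almost surely continuable, and so is their difference, which is supported on the
  residue class. By rotational symmetry the difference then continues across the whole circle, so its
  coefficients tend to 0. If the class contains infinitely many indices with concentration function
  bounded away from 1, this is impossible, since there the differences of the two copies are
  at least \<open>\<epsilon>\<close> with probability bounded away from 0. Finally, a radius of convergence larger than 1 would
  make the series continuable everywhere, so no second Borel--Cantelli argument is needed.
\<close>

section \<open>Continuation of power series across the unit circle\<close>

text \<open>The weight \<open>(real j + 1)\<^sup>2\<close> is the growth that Markov's inequality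
  and the first Borel-Cantelli lemma give for bounded first moments. A natural constant keeps the
  existential quantifier countable, hence measurable.\<close>

definition poly_growth :: "(nat \<Rightarrow> complex) \<Rightarrow> bool" where
  "poly_growth c \<longleftrightarrow> (\<exists>K::nat. \<forall>j. norm (c j) \<le> real K * (real j + 1)\<^sup>2)"

text \<open>When the series converges on the unit disc and \<open>norm w < 1\<close>, this is the
  usual Taylor coefficient of its sum at \<open>w\<close>, written through formal differentiation of
  \<open>c\<close> instead of \<open>deriv\<close>.\<close>

definition taylor_coeff :: "(nat \<Rightarrow> complex) \<Rightarrow> complex \<Rightarrow> nat \<Rightarrow> complex" where
  "taylor_coeff c w n = (\<Sum>j. (diffs ^^ n) c j * w ^ j) / fact n"

text \<open>
  For \<open>norm w < 1\<close>, holomorphic continuation to \<open>ball w \<rho>\<close> forces the second condition for every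
  smaller radius, and the condition yields a continuation to \<open>ball w \<rho>\<close>. In this form it is
  visibly linear and measurable in the coefficients.
\<close>

definition continuable :: "(nat \<Rightarrow> complex) \<Rightarrow> complex \<Rightarrow> real \<Rightarrow> bool" where
  "continuable c w \<rho> \<longleftrightarrow>
     poly_growth c \<and> (\<exists>K::nat. \<forall>n. norm (taylor_coeff c w n) * \<rho> ^ n \<le> real K)"

section \<open>Convergence and formal differentiation of power series\<close>

text \<open>Comparison with the geometric series differentiated twice, whose coefficients are
  \<open>(n + 1) * (n + 2)\<close>.\<close>

lemma poly_growth_summable:
  assumes "poly_growth c" "norm z < 1"
  shows "summable (\<lambda>j. c j * z ^ j)"
proof -
  obtain K :: nat where K: "\<And>j. norm (c j) \<le> real K * (real j + 1)\<^sup>2"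
    using assms(1) unfolding poly_growth_def by blast
  have 0: "summable (\<lambda>n. 1 * x ^ n)" if "norm x < 1" for x :: real
    using that by (simp add: summable_geometric)
  have 1: "summable (\<lambda>n. diffs (\<lambda>_. 1) n * x ^ n)" if "norm x < 1" for x :: real
    using that 0 by (rule termdiff_converges)
  have "summable (\<lambda>n. diffs (diffs (\<lambda>_. 1)) n * (norm z) ^ n)"
    by (rule termdiff_converges[where K=1]) (use assms(2) 1 in auto)
  then have "summable (\<lambda>n. real K * (diffs (diffs (\<lambda>_. 1)) n * (norm z) ^ n))"
    by (rule summable_mult)
  then show ?thesis
  proof (rule summable_comparison_test'[where N=0])
    fix n :: nat
    have "norm (c n) \<le> real K * ((real n + 1) * (real n + 2))"
      by (rule order.trans[OF K]) (auto simp: power2_eq_square intro!: mult_left_mono)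
    then have "norm (c n) * norm z ^ n \<le> (real K * ((real n + 1) * (real n + 2))) * norm z ^ n"
      by (rule mult_right_mono) simp
    then show "norm (c n * z ^ n) \<le> real K * (diffs (diffs (\<lambda>_. 1)) n * (norm z) ^ n)"
      by (simp add: diffs_def norm_mult norm_power algebra_simps)
  qed
qed

lemma poly_growth_diff:
  assumes "poly_growth c" "poly_growth d"
  shows "poly_growth (\<lambda>j. c j - d j)"
proof -
  obtain K L :: nat where K: "\<And>j. norm (c j) \<le> real K * (real j + 1)\<^sup>2"
    and L: "\<And>j. norm (d j) \<le> real L * (real j + 1)\<^sup>2"
    using assms unfolding poly_growth_def by blast
  have "norm (c j - d j) \<le> real (K + L) * (real j + 1)\<^sup>2" for j
    using norm_triangle_ineq4[of "c j" "d j"] K[of j] L[of j] by (simp add: algebra_simps)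
  then show ?thesis unfolding poly_growth_def by blast
qed

lemma eventually_le_imp_poly_growth:
  assumes "eventually (\<lambda>j. norm (c j) \<le> (real j + 1)\<^sup>2) sequentially"
  shows "poly_growth c"
proof -
  obtain N where N: "\<And>j. j \<ge> N \<Longrightarrow> norm (c j) \<le> (real j + 1)\<^sup>2"
    using assms unfolding eventually_sequentially by blast
  \<comment> \<open>The sum dominates each of the first \<open>N\<close> coefficients, and the added
    1 makes \<open>K\<close> large enough for the tail.\<close>
  define K where "K = nat \<lceil>\<Sum>j<N. norm (c j)\<rceil> + 1"
  have "norm (c j) \<le> real K * (real j + 1)\<^sup>2" for j
  proof (cases "j < N")
    case True
    have "norm (c j) \<le> (\<Sum>j<N. norm (c j))"
      using True by (intro member_le_sum) auto
    also have "\<dots> \<le> real K" unfolding K_def by linarith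
    also have "\<dots> \<le> real K * (real j + 1)\<^sup>2"
      using mult_left_mono[of 1 "(real j + 1)\<^sup>2" "real K"] by simp
    finally show ?thesis .
  next
    case False
    then have "norm (c j) \<le> 1 * (real j + 1)\<^sup>2" using N by simp
    also have "\<dots> \<le> real K * (real j + 1)\<^sup>2"
      by (intro mult_right_mono) (auto simp: K_def)
    finally show ?thesis .
  qed
  then show ?thesis unfolding poly_growth_def by blast
qed

lemma summable_diffs_funpow:
  fixes c :: "nat \<Rightarrow> complex"
  assumes "\<And>z. norm z < 1 \<Longrightarrow> summable (\<lambda>j. c j * z ^ j)" "norm z < 1"
  shows "summable (\<lambda>j. (diffs ^^ n) c j * z ^ j)"
  using assms(2)
proof (induction n arbitrary: z)
  case (Suc n)
  then show ?case
    using termdiff_converges[of z 1 "(diffs ^^ n) c"] by simp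
qed (use assms(1) in simp)

lemma higher_deriv_power_series:
  fixes c :: "nat \<Rightarrow> complex"
  assumes c: "\<And>z. norm z < 1 \<Longrightarrow> summable (\<lambda>j. c j * z ^ j)" and "norm z < 1"
  shows "(deriv ^^ n) (\<lambda>z. \<Sum>j. c j * z ^ j) z = (\<Sum>j. (diffs ^^ n) c j * z ^ j)"
  using assms(2)
proof (induction n arbitrary: z)
  case (Suc n)
  let ?f = "\<lambda>z. \<Sum>j. c j * z ^ j"
  \<comment> \<open>Differentiating once more requires the induction hypothesis on a neighbourhood
    of \<open>z\<close>.\<close>
  have "eventually (\<lambda>z. z \<in> ball 0 1) (nhds z)"
    using Suc.prems by (intro eventually_nhds_in_open) auto
  then have "eventually (\<lambda>z. (deriv ^^ n) ?f z = (\<Sum>j. (diffs ^^ n) c j * z ^ j)) (nhds z)"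
    by eventually_elim (use Suc.IH in auto)
  then have "deriv ((deriv ^^ n) ?f) z = deriv (\<lambda>z. \<Sum>j. (diffs ^^ n) c j * z ^ j) z"
    by (rule deriv_cong_ev) simp
  also have "\<dots> = (\<Sum>j. diffs ((diffs ^^ n) c) j * z ^ j)"
    by (rule DERIV_imp_deriv, rule termdiffs_strong'[where K=1])
       (use Suc.prems summable_diffs_funpow[OF c] in auto)
  finally show ?case by simp
qed simp

lemma holomorphic_on_power_series:
  fixes c :: "nat \<Rightarrow> complex"
  assumes "\<And>z. norm z < 1 \<Longrightarrow> summable (\<lambda>j. c j * z ^ j)"
  shows "(\<lambda>z. \<Sum>j. c j * z ^ j) holomorphic_on ball 0 1"
  by (rule power_series_holomorphic[where a=c]) (use assms in \<open>auto intro: summable_sums\<close>)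

lemma diffs_funpow_diff:
  "(diffs ^^ n) (\<lambda>j. c j - d j) = (\<lambda>j. (diffs ^^ n) c j - (diffs ^^ n) d j :: complex)"
proof (induction n)
  case (Suc n)
  show ?case
    unfolding funpow.simps o_apply Suc.IH by (simp add: diffs_def algebra_simps)
qed simp

lemma diffs_funpow_eq_0:
  fixes c :: "nat \<Rightarrow> complex"
  assumes "\<And>j. j \<ge> N \<Longrightarrow> c j = 0" "j + n \<ge> N"
  shows "(diffs ^^ n) c j = 0"
  using assms(2) by (induction n arbitrary: j) (auto simp: diffs_def assms(1))

lemma diffs_funpow_0: "(diffs ^^ n) (c :: nat \<Rightarrow> complex) 0 = fact n * c n"
proof -
  \<comment> \<open>Each \<open>diffs\<close> shifts the index by one, so the induction runs over
    all indices \<open>j\<close>.\<close>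
  have "fact j * (diffs ^^ n) c j = fact (j + n) * c (j + n)" for j
  proof (induction n arbitrary: j)
    case (Suc n)
    then show ?case using Suc[of "Suc j"] by (simp add: diffs_def algebra_simps)
  qed simp
  from this[of 0] show ?thesis by simp
qed

section \<open>Continuability under differences and finite modifications\<close>

lemma continuable_diff:
  assumes c: "continuable c w \<rho>" and d: "continuable d w \<rho>" and "norm w < 1" "\<rho> > 0"
  shows "continuable (\<lambda>j. c j - d j) w \<rho>"
proof -
  obtain K L :: nat where K: "\<And>n. norm (taylor_coeff c w n) * \<rho> ^ n \<le> real K"
    and L: "\<And>n. norm (taylor_coeff d w n) * \<rho> ^ n \<le> real L"
    using c d unfolding continuable_def by blast
  have s: "summable (\<lambda>j. (diffs ^^ n) c j * w ^ j)" "summable (\<lambda>j. (diffs ^^ n) d j * w ^ j)" for n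
    using c d assms(3) unfolding continuable_def
    by (auto intro!: summable_diffs_funpow intro: poly_growth_summable)
  have "norm (taylor_coeff (\<lambda>j. c j - d j) w n) * \<rho> ^ n \<le> real (K + L)" for n
  proof -
    have "taylor_coeff (\<lambda>j. c j - d j) w n = taylor_coeff c w n - taylor_coeff d w n"
      unfolding taylor_coeff_def diffs_funpow_diff using s[of n]
      by (simp add: left_diff_distrib diff_divide_distrib suminf_diff[symmetric])
    then have "norm (taylor_coeff (\<lambda>j. c j - d j) w n) * \<rho> ^ n
        \<le> (norm (taylor_coeff c w n) + norm (taylor_coeff d w n)) * \<rho> ^ n"
      using assms(4) by (intro mult_right_mono) (auto intro: norm_triangle_ineq4)
    also have "\<dots> \<le> real (K + L)"
      using K[of n] L[of n] by (simp add: algebra_simps)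
    finally show ?thesis .
  qed
  then show ?thesis
    using c d poly_growth_diff unfolding continuable_def by blast
qed

text \<open>A polynomial has only finitely many nonzero Taylor coefficients at \<open>w\<close>, so
  any radius is admissible.\<close>

lemma continuable_finite_support:
  assumes "\<And>j. j \<ge> N \<Longrightarrow> c j = 0" "\<rho> > 0"
  shows "continuable c w \<rho>"
proof -
  have "eventually (\<lambda>j. norm (c j) \<le> (real j + 1)\<^sup>2) sequentially"
    using eventually_ge_at_top[of N] by eventually_elim (auto simp: assms(1))
  moreover have "\<exists>K::nat. \<forall>n. norm (taylor_coeff c w n) * \<rho> ^ n \<le> real K"
  proof (intro exI allI)
    fix n
    let ?b = "\<lambda>n. norm (taylor_coeff c w n) * \<rho> ^ n"
    show "?b n \<le> real (nat \<lceil>\<Sum>n<N. ?b n\<rceil>)"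
    proof (cases "n < N")
      case True
      then have "?b n \<le> (\<Sum>n<N. ?b n)"
        using assms(2) by (intro member_le_sum) auto
      then show ?thesis by linarith
    next
      case False
      then have "taylor_coeff c w n = 0"
        unfolding taylor_coeff_def using diffs_funpow_eq_0[OF assms(1)] by simp
      then show ?thesis by simp
    qed
  qed
  ultimately show ?thesis
    unfolding continuable_def using eventually_le_imp_poly_growth by blast
qed

text \<open>The two sequences differ by a polynomial. This is what makes continuability of a random
  series a tail event.\<close>

lemma continuable_truncate_iff:
  assumes "norm w < 1" "\<rho> > 0"
  shows "continuable (\<lambda>j. if j < N then 0 else c j) w \<rho> \<longleftrightarrow> continuable c w \<rho>"
proof -
  let ?h = "\<lambda>j. if j < N then c j else 0" and ?t = "\<lambda>j. if j < N then 0 else c j"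
  have h: "continuable ?h w \<rho>" "continuable (\<lambda>j. - ?h j) w \<rho>"
    by (rule continuable_finite_support[of N]; use assms in simp)+
  have "(\<lambda>j. c j - ?h j) = ?t" "(\<lambda>j. ?t j - - ?h j) = c" by auto
  then show ?thesis
    using continuable_diff[OF _ h(1) assms, of c] continuable_diff[OF _ h(2) assms, of ?t] by auto
qed

section \<open>Continuability and holomorphic extension\<close>

text \<open>The coefficient bound makes the Taylor series at \<open>w\<close> converge on
  \<open>ball w \<rho>\<close> by comparison with a geometric series. It agrees with the original
  sum near \<open>w\<close>, hence on the whole overlap with the unit disc, which is convex.\<close>

lemma continuable_imp_extension:
  assumes c: "continuable c w \<rho>" and w: "norm w < 1" "\<rho> > 0"
  obtains g where "g holomorphic_on ball w \<rho>"
    "\<And>z. z \<in> ball w \<rho> \<Longrightarrow> norm z < 1 \<Longrightarrow> g z = (\<Sum>j. c j * z ^ j)"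
proof -
  let ?f = "\<lambda>z. \<Sum>j. c j * z ^ j"
  have sm: "\<And>z. norm z < 1 \<Longrightarrow> summable (\<lambda>j. c j * z ^ j)"
    using c poly_growth_summable unfolding continuable_def by blast
  obtain K :: nat where K: "\<And>n. norm (taylor_coeff c w n) * \<rho> ^ n \<le> real K"
    using c unfolding continuable_def by blast
  have hf: "?f holomorphic_on ball 0 1"
    using holomorphic_on_power_series[OF sm] .
  define g where "g z = (\<Sum>n. taylor_coeff c w n * (z - w) ^ n)" for z
  have s: "summable (\<lambda>n. taylor_coeff c w n * (z - w) ^ n)" if "z \<in> ball w \<rho>" for z
  proof (rule summable_comparison_test'[where N=0])
    define q where "q = norm (z - w) / \<rho>"
    have q: "0 \<le> q" "q < 1" using that w by (auto simp: q_def dist_norm norm_minus_commute)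
    then show "summable (\<lambda>n. real K * q ^ n)"
      by (intro summable_mult summable_geometric) simp
    fix n
    have "norm (taylor_coeff c w n * (z - w) ^ n) = norm (taylor_coeff c w n) * \<rho> ^ n * q ^ n"
      using w by (simp add: q_def norm_mult norm_power power_divide)
    also have "\<dots> \<le> real K * q ^ n"
      using K q by (intro mult_right_mono) auto
    finally show "norm (taylor_coeff c w n * (z - w) ^ n) \<le> real K * q ^ n" .
  qed
  have hg: "g holomorphic_on ball w \<rho>"
    by (rule power_series_holomorphic[where a="taylor_coeff c w"])
       (use s in \<open>auto simp: g_def intro: summable_sums\<close>)
  \<comment> \<open>A disc about \<open>w\<close> inside both domains, where the Taylor expansion of
    \<open>?f\<close> at \<open>w\<close> represents \<open>?f\<close>.\<close>
  define r where "r = min \<rho> (1 - norm w)"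
  have r: "r > 0" "ball w r \<subseteq> ball w \<rho> \<inter> ball 0 1"
  proof -
    show "r > 0" using w by (simp add: r_def)
    have "norm z < 1" if "dist w z < 1 - norm w" for z
      using norm_triangle_ineq[of w "z - w"] that by (simp add: dist_norm norm_minus_commute)
    then show "ball w r \<subseteq> ball w \<rho> \<inter> ball 0 1" by (auto simp: r_def)
  qed
  have eq: "g z = ?f z" if "z \<in> ball w r" for z
  proof -
    have "(\<lambda>n. (deriv ^^ n) ?f w / fact n * (z - w) ^ n) sums ?f z"
      by (rule holomorphic_power_series[OF _ that]) (use r(2) in \<open>auto intro: holomorphic_on_subset[OF hf]\<close>)
    also have "(\<lambda>n. (deriv ^^ n) ?f w / fact n * (z - w) ^ n) = (\<lambda>n. taylor_coeff c w n * (z - w) ^ n)"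
      using w by (simp add: higher_deriv_power_series[OF sm] taylor_coeff_def)
    finally show ?thesis unfolding g_def by (simp add: sums_iff)
  qed
  have "g z = ?f z" if "z \<in> ball w \<rho>" "norm z < 1" for z
  proof (rule analytic_continuation_open[where f=g and g="?f" and s="ball w r" and s'="ball w \<rho> \<inter> ball 0 1"])
    show "connected (ball w \<rho> \<inter> ball 0 1)" by (intro convex_connected convex_Int convex_ball)
  qed (use r eq that in \<open>auto intro: holomorphic_on_subset[OF hf] holomorphic_on_subset[OF hg]\<close>)
  with hg show ?thesis by (rule that)
qed

text \<open>The closed disc about \<open>p / 2\<close> of radius \<open>1 / 2\<close> touches the
  unit circle only at \<open>p\<close>, so it lies in the domain of \<open>g\<close>. By compactness
  a slightly larger disc does too, and Cauchy's inequality there bounds the Taylor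
  coefficients.\<close>

lemma extension_at_point_imp_continuable:
  assumes c: "poly_growth c" and p: "norm p = 1" "open U" "p \<in> U"
    and g: "g holomorphic_on (ball 0 1 \<union> U)" "\<And>z. z \<in> ball 0 1 \<Longrightarrow> g z = (\<Sum>j. c j * z ^ j)"
  shows "\<exists>\<rho>\<in>\<rat>. \<rho> > 1 / 2 \<and> continuable c (p / 2) \<rho>"
proof -
  have sub: "cball (p / 2) (1 / 2) \<subseteq> ball 0 1 \<union> U"
  proof
    fix z assume z: "z \<in> cball (p / 2) (1 / 2)"
    have "norm z \<le> 1"
      using norm_triangle_ineq[of "p / 2" "z - p / 2"] z p(1)
      by (simp add: dist_norm norm_minus_commute norm_divide)
    \<comment> \<open>Expanding the squared distance from \<open>p / 2\<close> gives
      \<open>z \<bullet> p \<ge> 1\<close>, which for unit vectors forces equality.\<close>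
    moreover have "z = p" if "norm z = 1"
    proof -
      have "(norm (p / 2 - z))\<^sup>2 \<le> (1 / 2)\<^sup>2"
        using z by (intro power_mono) (auto simp: dist_norm)
      moreover have inner_half: "(p / 2) \<bullet> z = (p \<bullet> z) / 2"
        by (simp add: inner_complex_def)
      ultimately have "z \<bullet> p \<ge> 1"
        using that p(1) dot_norm_neg[of "p / 2" z] inner_half
        by (simp add: inner_commute norm_divide power2_eq_square)
      then have "(norm (z - p))\<^sup>2 \<le> 0"
        using that p(1) dot_norm_neg[of z p] by simp
      then show ?thesis by simp
    qed
    ultimately show "z \<in> ball 0 1 \<union> U" using p(3) by fastforce
  qed
  obtain e where e: "e > 0" "(\<Union>z\<in>cball (p / 2) (1 / 2). cball z e) \<subseteq> ball 0 1 \<union> U"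
    using compact_subset_open_imp_cball_epsilon_subset[of "cball (p / 2) (1 / 2)" "ball 0 1 \<union> U"]
      sub p(2) by auto
  \<comment> \<open>A rational radius leaves only countably many discs to consider.\<close>
  obtain \<rho> where \<rho>: "\<rho> \<in> \<rat>" "1 / 2 < \<rho>" "\<rho> < 1 / 2 + e"
    using Rats_dense_in_real[of "1 / 2" "1 / 2 + e"] e(1) by auto
  have sub': "cball (p / 2) \<rho> \<subseteq> ball 0 1 \<union> U"
  proof
    fix z assume z: "z \<in> cball (p / 2) \<rho>"
    \<comment> \<open>\<open>u\<close> is \<open>z\<close> contracted towards \<open>p / 2\<close>
      by the factor \<open>1 / (2 * \<rho>)\<close>: it lies in the disc of radius
      \<open>1 / 2\<close>, at distance at most \<open>\<rho> - 1 / 2\<close> from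
      \<open>z\<close>.\<close>
    define u where "u = p / 2 + (z - p / 2) / of_real (2 * \<rho>)"
    have "dist (p / 2) u = norm (z - p / 2) / (2 * \<rho>)"
      using \<rho> by (simp add: u_def dist_norm norm_divide norm_mult)
    also have "\<dots> \<le> 1 / 2"
      using z \<rho> by (simp add: dist_norm norm_minus_commute field_simps)
    finally have u: "u \<in> cball (p / 2) (1 / 2)" by simp
    have "z - u = (z - p / 2) * of_real (1 - 1 / (2 * \<rho>))"
      by (simp add: u_def right_diff_distrib)
    then have "norm (z - u) = norm (z - p / 2) * (1 - 1 / (2 * \<rho>))"
      using \<rho> by (simp add: norm_mult del: of_real_diff of_real_divide)
    also have "\<dots> \<le> \<rho> * (1 - 1 / (2 * \<rho>))"
      using z \<rho> by (intro mult_right_mono) (auto simp: dist_norm norm_minus_commute)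
    also have "\<dots> = \<rho> - 1 / 2" using \<rho> by (simp add: field_simps)
    also have "\<dots> \<le> e" using \<rho> by simp
    finally have "z \<in> cball u e" by (simp add: dist_norm norm_minus_commute)
    with u e(2) show "z \<in> ball 0 1 \<union> U" by blast
  qed
  have cont: "continuous_on (cball (p / 2) \<rho>) g"
    using g(1) sub' holomorphic_on_imp_continuous_on continuous_on_subset by blast
  have "bounded (g ` cball (p / 2) \<rho>)"
    by (intro compact_imp_bounded compact_continuous_image cont compact_cball)
  then obtain B where B: "\<And>z. z \<in> cball (p / 2) \<rho> \<Longrightarrow> norm (g z) \<le> B"
    unfolding bounded_iff by blast
  have w: "norm (p / 2) < 1" using p(1) by (simp add: norm_divide)
  have "norm (taylor_coeff c (p / 2) n) * \<rho> ^ n \<le> real (nat \<lceil>B\<rceil>)" for n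
  proof -
    have "(deriv ^^ n) g (p / 2) = (deriv ^^ n) (\<lambda>z. \<Sum>j. c j * z ^ j) (p / 2)"
      by (rule higher_deriv_transform_within_open[of _ "ball 0 1"])
         (use g w holomorphic_on_power_series[OF poly_growth_summable[OF c]] in
           \<open>auto intro: holomorphic_on_subset\<close>)
    then have "taylor_coeff c (p / 2) n = (deriv ^^ n) g (p / 2) / fact n"
      using higher_deriv_power_series[OF poly_growth_summable[OF c] w] by (simp add: taylor_coeff_def)
    moreover have "norm ((deriv ^^ n) g (p / 2)) \<le> fact n * B / \<rho> ^ n"
    proof (rule Cauchy_inequality)
      show "g holomorphic_on ball (p / 2) \<rho>"
        using g(1) by (rule holomorphic_on_subset) (use sub' ball_subset_cball in blast)
    qed (use \<rho> cont B in \<open>auto simp: dist_norm\<close>)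
    ultimately have "norm (taylor_coeff c (p / 2) n) * \<rho> ^ n \<le> B"
      using \<rho> by (simp add: norm_divide pos_le_divide_eq pos_divide_le_eq) (simp add: field_simps)
    then show ?thesis by linarith
  qed
  then show ?thesis
    using \<rho> c unfolding continuable_def by blast
qed

lemma extends_through_imp_continuable:
  assumes c: "poly_growth c" and "\<alpha> < \<beta>" "extends_through c 1 (circle_arc 1 \<alpha> \<beta>)"
  shows "\<exists>\<theta>\<in>\<rat>. \<exists>\<rho>\<in>\<rat>. \<rho> > 1 / 2 \<and> continuable c (cis \<theta> / 2) \<rho>"
proof -
  obtain \<theta> where \<theta>: "\<theta> \<in> \<rat>" "\<alpha> < \<theta>" "\<theta> < \<beta>"
    using Rats_dense_in_real[OF assms(2)] by auto
  then have "cis \<theta> \<in> circle_arc 1 \<alpha> \<beta>" by (auto simp: circle_arc_def)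
  then show ?thesis
    using extension_at_point_imp_continuable[OF c, of "cis \<theta>"] assms(3) \<theta>(1)
    unfolding extends_through_def by (metis norm_cis subsetD)
qed

text \<open>
  The continuations glue together because two overlapping discs of equal radius centred on the unit
  circle overlap inside the unit disc, namely at the midpoint of their centres.
\<close>

lemma extension_around_circle_imp_tendsto_0:
  fixes c :: "nat \<Rightarrow> complex"
  assumes sm: "\<And>z. norm z < 1 \<Longrightarrow> summable (\<lambda>j. c j * z ^ j)" and "\<delta> > 0"
    and ext: "\<And>p. norm p = 1 \<Longrightarrow> \<exists>g. g holomorphic_on ball p \<delta> \<and>
                (\<forall>z\<in>ball p \<delta> \<inter> ball 0 1. g z = (\<Sum>j. c j * z ^ j))"
  shows "c \<longlonglongrightarrow> 0"
proof -
  let ?f = "\<lambda>z. \<Sum>j. c j * z ^ j"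
  have hf: "?f holomorphic_on ball 0 1" using holomorphic_on_power_series[OF sm] .
  obtain g where hg: "\<And>p. norm p = 1 \<Longrightarrow> g p holomorphic_on ball p \<delta>"
    and gf: "\<And>p z. norm p = 1 \<Longrightarrow> z \<in> ball p \<delta> \<inter> ball 0 1 \<Longrightarrow> g p z = ?f z"
  proof -
    have "\<forall>p. \<exists>g. norm p = 1 \<longrightarrow> g holomorphic_on ball p \<delta> \<and> (\<forall>z\<in>ball p \<delta> \<inter> ball 0 1. g z = ?f z)"
      using ext by blast
    from choice[OF this] that show ?thesis by blast
  qed
  have agree: "g p z = g q z"
    if pq: "norm p = 1" "norm q = 1" and z: "z \<in> ball p \<delta> \<inter> ball q \<delta>" for p q z :: complex
  proof (cases "p = q")
    case False
    have "(norm (p + q))\<^sup>2 + (norm (p - q))\<^sup>2 = 4"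
      using pq unfolding power2_norm_eq_inner norm_eq_1
      by (simp add: inner_add inner_diff inner_commute)
    moreover have "(norm (p - q))\<^sup>2 > 0" using False by simp
    ultimately have "(norm (p + q))\<^sup>2 < 4" by linarith
    then have "norm (p + q) < 2" by (intro power2_less_imp_less[of _ 2]) auto
    then have 1: "norm ((p + q) / 2) < 1" by (simp add: norm_divide)
    have "dist p q < 2 * \<delta>"
      using z dist_triangle[of p q z] by (simp add: dist_commute)
    moreover have "(p + q) / 2 = midpoint p q"
      by (simp add: midpoint_def scaleR_conv_of_real)
    ultimately have 2: "(p + q) / 2 \<in> ball p \<delta> \<inter> ball q \<delta>"
      by (simp add: dist_midpoint)
    show ?thesis
    proof (rule analytic_continuation_open[where f="g p" and g="g q" and s="ball p \<delta> \<inter> ball q \<delta> \<inter> ball 0 1"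
             and s'="ball p \<delta> \<inter> ball q \<delta>"])
      show "ball p \<delta> \<inter> ball q \<delta> \<inter> ball 0 1 \<noteq> {}" using 1 2 by auto
      show "connected (ball p \<delta> \<inter> ball q \<delta>)"
        by (intro convex_connected convex_Int convex_ball)
      show "g p holomorphic_on ball p \<delta> \<inter> ball q \<delta>" "g q holomorphic_on ball p \<delta> \<inter> ball q \<delta>"
        using hg pq by (auto intro: holomorphic_on_subset)
      show "g p z = g q z" if "z \<in> ball p \<delta> \<inter> ball q \<delta> \<inter> ball 0 1" for z
        using that pq gf by auto
    qed (use z in auto)
  qed simp
  \<comment> \<open>Outside the unit disc \<open>F\<close> uses the continuation around the nearest
    point of the circle, the radial projection \<open>sgn z\<close>.\<close>
  define F where "F z = (if norm z < 1 then ?f z else g (sgn z) z)" for z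
  have near: "z \<in> ball (sgn z) \<delta>" if "norm z \<ge> 1" "norm z < 1 + \<delta>" for z :: complex
  proof -
    have "sgn z - z = sgn z * of_real (1 - norm z)"
      using that by (cases "z = 0") (auto simp: sgn_eq field_simps)
    then have "dist (sgn z) z = norm z - 1"
      using that by (cases "z = 0") (auto simp: dist_norm norm_mult norm_sgn simp del: of_real_diff)
    then show ?thesis using that by simp
  qed
  have Fg: "F z = g p z" if "norm p = 1" "z \<in> ball p \<delta>" "norm z < 1 + \<delta>" for p z
  proof (cases "norm z < 1")
    case False
    then have "norm (sgn z) = 1" by (auto simp: norm_sgn)
    then show ?thesis using False that agree[of "sgn z" p z] near[of z] by (auto simp: F_def)
  qed (use that gf in \<open>auto simp: F_def\<close>)
  have "F field_differentiable at z" if "norm z < 1 + \<delta>" for z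
  proof (cases "norm z < 1")
    case True
    have "F holomorphic_on ball 0 1"
      by (rule holomorphic_transform[OF hf]) (auto simp: F_def)
    then show ?thesis
      using True by (intro holomorphic_on_imp_differentiable_at[of F "ball 0 1"]) auto
  next
    case False
    then have n: "norm (sgn z) = 1" by (auto simp: norm_sgn)
    let ?V = "ball (sgn z) \<delta> \<inter> ball 0 (1 + \<delta>)"
    have "g (sgn z) holomorphic_on ?V"
      using hg[OF n] by (rule holomorphic_on_subset) auto
    then have "F holomorphic_on ?V"
      by (rule holomorphic_transform) (use Fg[OF n] in auto)
    then show ?thesis
      using False near[of z] that by (intro holomorphic_on_imp_differentiable_at[of F ?V]) auto
  qed
  then have F: "F holomorphic_on ball 0 (1 + \<delta>)"
    by (auto simp: holomorphic_on_def intro: field_differentiable_at_within)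
  \<comment> \<open>\<open>F\<close> is holomorphic on a disc containing 1, so its Taylor series at
    0, which is the original series, converges at 1.\<close>
  have "(\<lambda>n. (deriv ^^ n) F 0 / fact n * (1 - 0) ^ n) sums F 1"
    by (rule holomorphic_power_series[OF F]) (use assms(2) in auto)
  moreover have "(deriv ^^ n) F 0 / fact n = c n" for n
  proof -
    have "(deriv ^^ n) F 0 = (deriv ^^ n) ?f 0"
      by (rule higher_deriv_transform_within_open[of _ "ball 0 1"])
         (use hf F assms(2) in \<open>auto simp: F_def intro: holomorphic_on_subset\<close>)
    also have "\<dots> = (\<Sum>j. (diffs ^^ n) c j * 0 ^ j)"
      by (rule higher_deriv_power_series[OF sm]) auto
    also have "\<dots> = fact n * c n"
      by (subst powser_zero) (simp add: diffs_funpow_0)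
    finally show ?thesis by simp
  qed
  ultimately have "summable c" by (simp add: sums_iff)
  then show ?thesis by (rule summable_LIMSEQ_zero)
qed

section \<open>Rotations and series supported on one residue class\<close>

text \<open>A chord of the unit circle is at most as long as its arc.\<close>

lemma dist_cis_le: "dist (cis a) (cis b) \<le> \<bar>a - b\<bar>"
proof -
  have "cis a - cis b = cis b * (cis (a - b) - 1)"
    by (simp add: right_diff_distrib cis_mult)
  then have "dist (cis a) (cis b) = norm (exp (\<i> * of_real (a - b)) - 1)"
    by (simp add: dist_norm norm_mult cis_conv_exp del: of_real_diff)
  also have "\<dots> = 2 * \<bar>sin ((a - b) / 2)\<bar>"
    by (rule dist_exp_i_1)
  also have "\<dots> \<le> \<bar>a - b\<bar>"
    using abs_sin_x_le_abs_x[of "(a - b) / 2"] by simp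
  finally show ?thesis .
qed

text \<open>
  A series supported on one residue class modulo \<open>m\<close> is, up to a unimodular factor, invariant
  under rotation by \<open>2 * pi / m\<close>, so its continuation near one point of the circle spreads to the
  whole circle once \<open>m\<close> is large.
\<close>

lemma continuable_residue_class_tendsto_0:
  assumes c: "continuable c (cis \<theta> / 2) \<rho>" and \<rho>: "\<rho> > 1 / 2"
    and m: "m > 0" "2 * pi / real m \<le> (\<rho> - 1 / 2) / 2"
    and supp: "\<And>j. j mod m \<noteq> k \<Longrightarrow> c j = 0"
  shows "c \<longlonglongrightarrow> 0"
proof -
  let ?f = "\<lambda>z. \<Sum>j. c j * z ^ j"
  \<comment> \<open>The excess of \<open>\<rho>\<close> over \<open>1 / 2\<close> is split in two:
    half for the error of the rotation, half for the radius of the disc about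
    \<open>p\<close>.\<close>
  define \<delta> where "\<delta> = (\<rho> - 1 / 2) / 2"
  have sm: "\<And>z. norm z < 1 \<Longrightarrow> summable (\<lambda>j. c j * z ^ j)"
    using c poly_growth_summable unfolding continuable_def by blast
  obtain g where hg: "g holomorphic_on ball (cis \<theta> / 2) \<rho>"
    and gf: "\<And>z. z \<in> ball (cis \<theta> / 2) \<rho> \<Longrightarrow> norm z < 1 \<Longrightarrow> g z = ?f z"
    using continuable_imp_extension[OF c] \<rho> by (auto simp: norm_divide)
  show ?thesis
  proof (rule extension_around_circle_imp_tendsto_0[OF sm])
    show "\<delta> > 0" using \<rho> by (simp add: \<delta>_def)
    fix p :: complex assume p: "norm p = 1"
    define \<phi> where "\<phi> = Arg p"
    have p_cis: "p = cis \<phi>"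
      using p cis_Arg[of p] by (cases "p = 0") (auto simp: \<phi>_def sgn_eq)
    \<comment> \<open>\<open>l\<close> steps of \<open>2 * pi / m\<close> carry \<open>p\<close> to
      within one step of \<open>cis \<theta>\<close>.\<close>
    define l where "l = \<lfloor>(\<theta> - \<phi>) * real m / (2 * pi)\<rfloor>"
    define \<zeta> where "\<zeta> = cis (2 * pi * of_int l / real m)"
    have n\<zeta>: "norm \<zeta> = 1" by (simp add: \<zeta>_def)
    have "\<zeta> ^ m = cis (2 * pi * of_int l)"
      using m(1) by (simp add: \<zeta>_def Complex.DeMoivre)
    also have "\<dots> = 1" by (rule cis_multiple_2pi) simp
    finally have \<zeta>m: "\<zeta> ^ m = 1" .
    \<comment> \<open>All exponents that occur are congruent to \<open>k\<close> modulo
      \<open>m\<close>, and \<open>\<zeta>\<close> is an \<open>m\<close>-th root of unity.\<close>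
    have rot: "?f (\<zeta> * z) = \<zeta> ^ k * ?f z" if "norm z < 1" for z
    proof -
      have eq: "c j * (\<zeta> * z) ^ j = \<zeta> ^ k * (c j * z ^ j)" for j
      proof (cases "j mod m = k")
        case True
        have "\<zeta> ^ j = \<zeta> ^ (m * (j div m) + j mod m)" by simp
        also have "\<dots> = \<zeta> ^ k" unfolding power_add power_mult \<zeta>m True by simp
        finally show ?thesis by (simp add: power_mult_distrib)
      qed (use supp in simp)
      show ?thesis unfolding eq by (rule suminf_mult[OF sm[OF that]])
    qed
    have "dist (\<zeta> * p) (cis \<theta>) \<le> \<bar>2 * pi * of_int l / real m + \<phi> - \<theta>\<bar>"
      unfolding p_cis \<zeta>_def cis_mult by (rule dist_cis_le)
    also have "\<dots> = (2 * pi / real m) * \<bar>of_int l - (\<theta> - \<phi>) * real m / (2 * pi)\<bar>"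
    proof -
      have "2 * pi * of_int l / real m + \<phi> - \<theta>
          = (2 * pi / real m) * (of_int l - (\<theta> - \<phi>) * real m / (2 * pi))"
        using m(1) by (simp add: field_simps)
      then show ?thesis by (simp add: abs_mult)
    qed
    also have "\<dots> \<le> (2 * pi / real m) * 1"
      by (intro mult_left_mono) (auto simp: l_def, linarith)
    finally have d: "dist (\<zeta> * p) (cis \<theta>) \<le> \<delta>" using m(2) by (simp add: \<delta>_def)
    have into: "\<zeta> * z \<in> ball (cis \<theta> / 2) \<rho>" if "z \<in> ball p \<delta>" for z
    proof -
      have "dist (cis \<theta> / 2) (cis \<theta>) = norm (cis \<theta> / 2)"
        by (subst norm_minus_cancel[symmetric]) (simp add: dist_norm)
      then have "dist (cis \<theta> / 2) (cis \<theta>) = 1 / 2" by (simp add: norm_divide)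
      moreover have "dist (\<zeta> * p) (\<zeta> * z) = dist p z"
        using n\<zeta> by (simp add: dist_norm norm_mult flip: right_diff_distrib)
      moreover have "dist p z < \<delta>" using that by simp
      ultimately have "dist (cis \<theta> / 2) (\<zeta> * z) < 1 / 2 + \<delta> + \<delta>"
        using dist_triangle[of "cis \<theta> / 2" "\<zeta> * z" "cis \<theta>"]
          dist_triangle[of "cis \<theta>" "\<zeta> * z" "\<zeta> * p"] d by (simp add: dist_commute)
      then show ?thesis by (simp add: \<delta>_def field_simps)
    qed
    \<comment> \<open>The continuation near \<open>cis \<theta>\<close> is pulled back to
      \<open>p\<close>; dividing by \<open>\<zeta> ^ k\<close> undoes the factor from
      \<open>rot\<close>.\<close>
    have "(\<lambda>z. g (\<zeta> * z) / \<zeta> ^ k) holomorphic_on ball p \<delta>"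
    proof (intro holomorphic_intros)
      show "(\<lambda>z. g (\<zeta> * z)) holomorphic_on ball p \<delta>"
      proof -
        have "(\<lambda>z. \<zeta> * z) ` ball p \<delta> \<subseteq> ball (cis \<theta> / 2) \<rho>" using into by blast
        then have "(g \<circ> (\<lambda>z. \<zeta> * z)) holomorphic_on ball p \<delta>"
          by (intro holomorphic_on_compose_gen[OF _ hg]) (intro holomorphic_intros)
        then show ?thesis by (simp add: o_def)
      qed
    qed (use n\<zeta> in auto)
    moreover have "g (\<zeta> * z) / \<zeta> ^ k = ?f z" if z: "z \<in> ball p \<delta> \<inter> ball 0 1" for z
    proof -
      have "\<zeta> \<noteq> 0" using n\<zeta> by auto
      then show ?thesis
        using gf[of "\<zeta> * z"] into[of z] rot[of z] z n\<zeta> by (simp add: norm_mult)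
    qed
    ultimately show "\<exists>g. g holomorphic_on ball p \<delta> \<and> (\<forall>z\<in>ball p \<delta> \<inter> ball 0 1. g z = ?f z)"
      by blast
  qed
qed

section \<open>Random coefficients\<close>

lemma sets_continuable:
  assumes [measurable]: "\<And>j. X j \<in> borel_measurable N"
  shows "{\<omega>\<in>space N. continuable (\<lambda>j. X j \<omega>) w \<rho>} \<in> sets N"
proof -
  have [measurable]: "(\<lambda>\<omega>. (diffs ^^ n) (\<lambda>j. X j \<omega>) j) \<in> borel_measurable N" for n j
    by (induction n arbitrary: j) (simp_all add: diffs_def)
  show ?thesis
    unfolding continuable_def poly_growth_def taylor_coeff_def by measurable
qed

text \<open>Truncation does not affect continuability, so the event is determined by the
  coefficients from any index \<open>n\<close> on, and Kolmogorov's law applies.\<close>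

lemma (in prob_space) prob_continuable_0_1:
  fixes a :: "nat \<Rightarrow> 'a \<Rightarrow> real"
  assumes indep: "indep_vars (\<lambda>_. borel) a UNIV" and w: "norm w < 1" "\<rho> > 0"
  defines "G \<equiv> {\<omega>\<in>space M. continuable (\<lambda>j. complex_of_real (a j \<omega>)) w \<rho>}"
  shows "prob G = 0 \<or> prob G = 1"
proof -
  let ?A = "\<lambda>j. sigma_sets (space M) {a j -` B \<inter> space M |B. B \<in> sets borel}"
  have "G \<in> sigma_sets (space M) (\<Union>j\<in>{n..}. ?A j)" for n
  proof -
    \<comment> \<open>The sigma-algebra generated by the \<open>a j\<close> with
      \<open>j \<ge> n\<close>; measurability of the event is proved relative to it.\<close>
    define N where "N = sigma (space M) (\<Union>j\<in>{n..}. ?A j)"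
    have pow: "(\<Union>j\<in>{n..}. ?A j) \<subseteq> Pow (space M)"
      by (auto dest!: sigma_sets_into_sp[rotated])
    have N: "space N = space M" "sets N = sigma_sets (space M) (\<Union>j\<in>{n..}. ?A j)"
      using pow by (simp_all add: N_def)
    have meas: "a j \<in> borel_measurable N" if "j \<ge> n" for j
    proof (rule measurableI)
      fix B :: "real set" assume "B \<in> sets borel"
      then have "a j -` B \<inter> space M \<in> ?A j" by (auto intro!: sigma_sets.Basic)
      then show "a j -` B \<inter> space N \<in> sets N"
        unfolding N using that by (intro sigma_sets.Basic) auto
    qed simp
    have "{\<omega>\<in>space N. continuable (\<lambda>j. if j < n then 0 else complex_of_real (a j \<omega>)) w \<rho>} \<in> sets N"
    proof (rule sets_continuable)
      fix j show "(\<lambda>\<omega>. if j < n then 0 else complex_of_real (a j \<omega>)) \<in> borel_measurable N"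
        using meas[of j] by (cases "j < n") auto
    qed
    then show ?thesis
      unfolding G_def using N continuable_truncate_iff[OF w] by simp
  qed
  then have "G \<in> tail_events ?A" unfolding tail_events_def by simp
  moreover have "indep_sets ?A UNIV" using indep unfolding indep_vars_def by simp
  moreover have "sigma_algebra (space M) (?A j)" for j
    by (rule sigma_algebra_sigma_sets) auto
  ultimately show ?thesis by (intro kolmogorov_0_1_law[where A="?A"]) auto
qed

section \<open>Independent copies and concentration\<close>

text \<open>Resampling the coordinates in \<open>S\<close> from an independent copy preserves the
  product law: the map acts coordinatewise, both projections send
  \<open>\<nu> j \<Otimes>\<^sub>M \<nu> j\<close> to \<open>\<nu> j\<close>, and it suffices to
  compare cylinders.\<close>

lemma distr_PiM_pair_select:
  fixes \<nu> :: "'i \<Rightarrow> 'a measure"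
  assumes \<nu>: "\<And>j. prob_space (\<nu> j)"
  shows "distr (PiM UNIV (\<lambda>j. \<nu> j \<Otimes>\<^sub>M \<nu> j)) (PiM UNIV \<nu>)
           (\<lambda>z j. if j \<in> S then snd (z j) else fst (z j)) = PiM UNIV \<nu>"
proof -
  let ?h = "\<lambda>j x. if j \<in> S then snd x else fst x"
  let ?Q = "PiM UNIV (\<lambda>j. \<nu> j \<Otimes>\<^sub>M \<nu> j)"
  interpret V: product_prob_space \<nu> UNIV
    using \<nu> by (rule product_prob_spaceI)
  have pair: "prob_space (\<nu> j \<Otimes>\<^sub>M \<nu> j)" for j
    using \<nu>[of j] \<nu>[of j] by (rule prob_space_pair)
  interpret Q: product_prob_space "\<lambda>j. \<nu> j \<Otimes>\<^sub>M \<nu> j" UNIV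
    using pair by (rule product_prob_spaceI)
  have h[measurable]: "?h j \<in> measurable (\<nu> j \<Otimes>\<^sub>M \<nu> j) (\<nu> j)" for j
    by (cases "j \<in> S") auto
  have hd: "distr (\<nu> j \<Otimes>\<^sub>M \<nu> j) (\<nu> j) (?h j) = \<nu> j" for j
  proof -
    interpret P: prob_space "\<nu> j" by (rule \<nu>)
    interpret PP: pair_sigma_finite "\<nu> j" "\<nu> j" ..
    have "distr (\<nu> j \<Otimes>\<^sub>M \<nu> j) (\<nu> j) snd = \<nu> j"
      by (subst PP.distr_pair_swap) (simp add: distr_distr comp_def prob_space.distr_pair_fst[OF \<nu>] case_prod_beta')
    then show ?thesis by (cases "j \<in> S") (simp_all add: prob_space.distr_pair_fst[OF \<nu>])
  qed
  have meas: "(\<lambda>z j. ?h j (z j)) \<in> measurable ?Q (PiM UNIV \<nu>)"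
  proof (rule measurable_PiM_single')
    show "(\<lambda>z. ?h j (z j)) \<in> measurable ?Q (\<nu> j)" for j
      by (cases "j \<in> S") auto
  qed (auto simp: space_PiM space_pair_measure PiE_iff mem_Times_iff split: if_splits)
  show ?thesis
  proof (rule V.PiM_eq)
    fix J F assume J: "finite J" "J \<subseteq> UNIV" and F: "\<And>j. j \<in> J \<Longrightarrow> F j \<in> sets (\<nu> j)"
    let ?H = "\<lambda>j. ?h j -` F j \<inter> space (\<nu> j \<Otimes>\<^sub>M \<nu> j)"
    have "emeasure (distr ?Q (PiM UNIV \<nu>) (\<lambda>z j. ?h j (z j))) (prod_emb UNIV \<nu> J (\<Pi>\<^sub>E j\<in>J. F j))
        = emeasure ?Q ((\<lambda>z j. ?h j (z j)) -` prod_emb UNIV \<nu> J (\<Pi>\<^sub>E j\<in>J. F j) \<inter> space ?Q)"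
      using J F by (intro emeasure_distr meas sets_PiM_I) auto
    also have "(\<lambda>z j. ?h j (z j)) -` prod_emb UNIV \<nu> J (\<Pi>\<^sub>E j\<in>J. F j) \<inter> space ?Q
        = {z\<in>space ?Q. \<forall>j\<in>J. z j \<in> ?H j}"
      using measurable_space[OF meas]
      by (auto simp: prod_emb_def space_PiM PiE_iff split del: if_split)
    also have "emeasure ?Q \<dots> = (\<Prod>j\<in>J. emeasure (\<nu> j \<Otimes>\<^sub>M \<nu> j) (?H j))"
      using J F by (intro Q.emeasure_PiM_Collect measurable_sets[OF h]) auto
    also have "\<dots> = (\<Prod>j\<in>J. emeasure (\<nu> j) (F j))"
    proof (rule prod.cong)
      fix j assume "j \<in> J"
      then have "emeasure (distr (\<nu> j \<Otimes>\<^sub>M \<nu> j) (\<nu> j) (?h j)) (F j) = emeasure (\<nu> j \<Otimes>\<^sub>M \<nu> j) (?H j)"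
        using F by (intro emeasure_distr h) auto
      then show "emeasure (\<nu> j \<Otimes>\<^sub>M \<nu> j) (?H j) = emeasure (\<nu> j) (F j)" by (simp add: hd)
    qed simp
    finally show "emeasure (distr ?Q (PiM UNIV \<nu>) (\<lambda>z j. ?h j (z j)))
        (prod_emb UNIV \<nu> J (\<Pi>\<^sub>E j\<in>J. F j)) = (\<Prod>j\<in>J. emeasure (\<nu> j) (F j))" .
  qed simp
qed

text \<open>Dominated convergence for the indicators of the events.\<close>

lemma (in prob_space) AE_eventually_not_imp_prob_tendsto_0:
  assumes [measurable]: "\<And>n. A n \<in> events" and "AE \<omega> in M. eventually (\<lambda>n. \<omega> \<notin> A n) sequentially"
  shows "(\<lambda>n. prob (A n)) \<longlonglongrightarrow> 0"
proof -
  have "(\<lambda>n. integral\<^sup>L M (indicator (A n) :: 'a \<Rightarrow> real)) \<longlonglongrightarrow> integral\<^sup>L M (\<lambda>_. 0::real)"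
  proof (rule integral_dominated_convergence[where w="\<lambda>_. 1"])
    show "AE \<omega> in M. (\<lambda>n. indicator (A n) \<omega> :: real) \<longlonglongrightarrow> 0"
      using assms(2)
    proof eventually_elim
      case (elim \<omega>)
      then have "eventually (\<lambda>n. (indicator (A n) \<omega> :: real) = 0) sequentially"
        by eventually_elim simp
      then show ?case by (rule tendsto_eventually)
    qed
  qed auto
  then show ?thesis by (simp add: sets.Int_space_eq2)
qed

text \<open>Fubini: with the second copy fixed at \<open>t\<close>, the first is within
  \<open>\<delta>\<close> of \<open>t\<close> with probability at most the concentration
  function.\<close>

lemma (in prob_space) measure_pair_dist_ge:
  fixes X :: "'a \<Rightarrow> real"
  assumes [measurable]: "random_variable borel X"
  defines "\<nu> \<equiv> distr M borel X"
  shows "measure (\<nu> \<Otimes>\<^sub>M \<nu>) {x\<in>space (\<nu> \<Otimes>\<^sub>M \<nu>). \<bar>fst x - snd x\<bar> \<ge> \<delta>} \<ge> 1 - levy_concentration M X \<delta>"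
proof -
  have [measurable_cong]: "sets \<nu> = sets borel" by (simp add: \<nu>_def)
  interpret P: prob_space \<nu> unfolding \<nu>_def by (rule prob_space_distr) simp
  interpret PP: pair_prob_space \<nu> \<nu> ..
  let ?E = "{x\<in>space (\<nu> \<Otimes>\<^sub>M \<nu>). \<bar>fst x - snd x\<bar> \<ge> \<delta>}"
  let ?L = "levy_concentration M X \<delta>"
  have [measurable]: "?E \<in> sets (\<nu> \<Otimes>\<^sub>M \<nu>)" by measurable
  have sl: "1 - ?L \<le> measure \<nu> ((\<lambda>x. (x, t)) -` ?E)" for t
  proof -
    have "prob {\<omega>\<in>space M. \<bar>X \<omega> - t\<bar> < \<delta>} \<le> ?L"
      unfolding levy_concentration_def by (rule cSUP_upper) (auto intro!: bdd_aboveI[of _ 1])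
    moreover have "(\<lambda>x. (x, t)) -` ?E = {x. \<bar>x - t\<bar> \<ge> \<delta>}"
      by (auto simp: space_pair_measure \<nu>_def)
    moreover have "measure \<nu> {x. \<bar>x - t\<bar> \<ge> \<delta>} = prob {\<omega>\<in>space M. \<not> \<bar>X \<omega> - t\<bar> < \<delta>}"
      unfolding \<nu>_def by (subst measure_distr) (auto intro!: arg_cong[where f=prob])
    ultimately show ?thesis
      using prob_neg[of "\<lambda>\<omega>. \<bar>X \<omega> - t\<bar> < \<delta>"] by simp
  qed
  have "ennreal (1 - ?L) = (\<integral>\<^sup>+t. ennreal (1 - ?L) \<partial>\<nu>)"
    by (simp add: P.emeasure_space_1)
  also have "\<dots> \<le> (\<integral>\<^sup>+t. emeasure \<nu> ((\<lambda>x. (x, t)) -` ?E) \<partial>\<nu>)"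
    using sl by (intro nn_integral_mono) (simp add: P.emeasure_eq_measure ennreal_leI)
  also have "\<dots> = emeasure (\<nu> \<Otimes>\<^sub>M \<nu>) ?E"
    by (rule PP.emeasure_pair_measure_alt2[symmetric]) simp
  finally show ?thesis
    by (simp add: PP.emeasure_eq_measure)
qed

lemma (in prob_space) prob_continuable_eq_0:
  fixes a :: "nat \<Rightarrow> 'a \<Rightarrow> real"
  assumes indep: "indep_vars (\<lambda>_. borel) a UNIV" and \<rho>: "\<rho> > 1 / 2" and "\<epsilon> > 0"
    and conc: "liminf (\<lambda>j. ereal (levy_concentration M (a j) \<epsilon>)) < 1"
  shows "prob {\<omega>\<in>space M. continuable (\<lambda>j. complex_of_real (a j \<omega>)) (cis \<theta> / 2) \<rho>} = 0"
proof (rule ccontr)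
  let ?w = "cis \<theta> / 2"
  let ?C = "\<lambda>x. continuable (\<lambda>j. complex_of_real (x j)) ?w \<rho>"
  have w: "norm ?w < 1" "\<rho> > 0" using \<rho> by (auto simp: norm_divide)
  have rv[measurable]: "random_variable borel (a j)" for j
    using indep unfolding indep_vars_def by auto
  assume "prob {\<omega>\<in>space M. ?C (\<lambda>j. a j \<omega>)} \<noteq> 0"
  then have "prob {\<omega>\<in>space M. ?C (\<lambda>j. a j \<omega>)} = 1"
    using prob_continuable_0_1[OF indep w] by blast
  then have AE: "AE \<omega> in M. ?C (\<lambda>j. a j \<omega>)"
    by (subst (asm) prob_Collect_eq_1) (auto intro!: sets_continuable)

  define \<nu> where "\<nu> j = distr M borel (a j)" for j
  have sets_\<nu>[measurable_cong]: "sets (\<nu> j) = sets borel" for j by (simp add: \<nu>_def)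
  have \<nu>: "prob_space (\<nu> j)" for j unfolding \<nu>_def by (rule prob_space_distr) simp
  let ?P = "PiM UNIV \<nu>" and ?Q = "PiM UNIV (\<lambda>j. \<nu> j \<Otimes>\<^sub>M \<nu> j)"
  have sets_P[measurable_cong]: "sets ?P = sets (PiM UNIV (\<lambda>_::nat. borel))"
    by (intro sets_PiM_cong) (auto simp: sets_\<nu>)
  interpret Q: product_prob_space "\<lambda>j. \<nu> j \<Otimes>\<^sub>M \<nu> j" UNIV
    by (intro product_prob_spaceI prob_space_pair \<nu>)
  have C_sets: "{x\<in>space ?P. ?C x} \<in> sets ?P"
    by (rule sets_continuable) measurable
  \<comment> \<open>Independence as an identity of laws: the joint law of the coefficients is the
    product of the marginals.\<close>
  have "distr M (PiM UNIV (\<lambda>_. borel)) (\<lambda>\<omega> j. a j \<omega>) = ?P"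
    using indep indep_vars_iff_distr_eq_PiM[where I=UNIV and M'="\<lambda>_. borel" and X=a] unfolding \<nu>_def
    by (simp add: restrict_UNIV)
  then have law: "distr M ?P (\<lambda>\<omega> j. a j \<omega>) = ?P"
    using distr_cong[OF refl sets_P, of M] by metis
  have "AE x in distr M ?P (\<lambda>\<omega> j. a j \<omega>). ?C x"
    using AE C_sets by (subst AE_distr_iff) (auto simp: measurable_cong_sets[OF refl sets_P] intro!: measurable_PiM_single')
  then have AEP: "AE x in ?P. ?C x" unfolding law .

  have select: "AE z in ?Q. ?C (\<lambda>j. if j \<in> S then snd (z j) else fst (z j))" for S
  proof -
    have [measurable]: "(\<lambda>z j. if j \<in> S then snd (z j) else fst (z j)) \<in> measurable ?Q ?P"
    proof (rule measurable_PiM_single')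
      fix j :: nat
      show "(\<lambda>z. if j \<in> S then snd (z j) else fst (z j)) \<in> measurable ?Q (\<nu> j)"
        by (cases "j \<in> S") auto
    qed (auto simp: space_PiM \<nu>_def)
    have "AE x in distr ?Q ?P (\<lambda>z j. if j \<in> S then snd (z j) else fst (z j)). ?C x"
      unfolding distr_PiM_pair_select[OF \<nu>] by (rule AEP)
    then show ?thesis using C_sets by (subst (asm) AE_distr_iff) auto
  qed

  \<comment> \<open>\<open>1 - r\<close> will be the uniform lower bound for the probability that
    the two copies differ by at least \<open>\<epsilon>\<close>.\<close>
  obtain r where r: "liminf (\<lambda>j. ereal (levy_concentration M (a j) \<epsilon>)) < ereal r" "r < 1"
    using ereal_dense2[OF conc] by auto
  have "\<exists>\<^sub>F j in sequentially. levy_concentration M (a j) \<epsilon> < r"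
  proof (rule ccontr)
    assume "\<not> ?thesis"
    then have "\<forall>\<^sub>F j in sequentially. ereal r \<le> ereal (levy_concentration M (a j) \<epsilon>)"
      by (simp add: not_frequently not_less)
    then have "ereal r \<le> liminf (\<lambda>j. ereal (levy_concentration M (a j) \<epsilon>))"
      by (rule Liminf_bounded)
    with r(1) show False by simp
  qed
  then have inf: "infinite {j. levy_concentration M (a j) \<epsilon> < r}"
    by (simp add: frequently_cofinite flip: cofinite_eq_sequentially)
  \<comment> \<open>This makes one rotation by \<open>2 * pi / m\<close> at most half the excess of
    \<open>\<rho>\<close> over \<open>1 / 2\<close>.\<close>
  obtain m :: nat where m: "2 * pi / ((\<rho> - 1 / 2) / 2) < real m"
    using reals_Archimedean2 by blast
  moreover have "0 < 2 * pi / ((\<rho> - 1 / 2) / 2)" using \<rho> by (intro divide_pos_pos) auto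
  ultimately have m0: "m > 0" by linarith
  with m have m': "2 * pi / real m \<le> (\<rho> - 1 / 2) / 2" using \<rho> by (simp add: field_simps)
  have "finite ((\<lambda>j. j mod m) ` {j. levy_concentration M (a j) \<epsilon> < r})"
    by (rule finite_subset[of _ "{..<m}"]) (use m0 in auto)
  from pigeonhole_infinite[OF inf this] obtain k
    where k: "infinite {j. levy_concentration M (a j) \<epsilon> < r \<and> j mod m = k}" by auto
  define S where "S = {j. j mod m = k}"

  \<comment> \<open>With \<open>j \<in> S\<close> inside the event, \<open>A j\<close> is empty off
    the residue class, so its limit can be taken along all \<open>j\<close>.\<close>
  define A where "A j = {z\<in>space ?Q. j \<in> S \<and> \<epsilon> \<le> \<bar>fst (z j) - snd (z j)\<bar>}" for j
  have A_sets: "A j \<in> sets ?Q" for j unfolding A_def by measurable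
  \<comment> \<open>Taking \<open>{}\<close> in \<open>select\<close> gives the first copy itself;
    its difference from the version resampled on \<open>S\<close> vanishes off
    \<open>S\<close>.\<close>
  have "AE z in ?Q. eventually (\<lambda>j. z \<notin> A j) sequentially"
    using select[of S] select[of "{}"]
  proof eventually_elim
    case (elim z)
    let ?d = "\<lambda>j. complex_of_real (fst (z j))
                 - complex_of_real (if j \<in> S then snd (z j) else fst (z j))"
    have "continuable ?d ?w \<rho>"
      using elim w by (intro continuable_diff) auto
    then have "?d \<longlonglongrightarrow> 0"
      by (rule continuable_residue_class_tendsto_0[where k=k, OF _ \<rho> m0 m']) (auto simp: S_def)
    then have "eventually (\<lambda>j. norm (?d j) < \<epsilon>) sequentially"
      using \<open>\<epsilon> > 0\<close> by (auto simp: tendsto_iff dist_norm)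
    then show ?case
    proof eventually_elim
      case (elim j)
      then show ?case
        unfolding A_def by (auto simp flip: of_real_diff)
    qed
  qed
  then have lim: "(\<lambda>j. Q.P.prob (A j)) \<longlonglongrightarrow> 0"
    using A_sets by (intro Q.P.AE_eventually_not_imp_prob_tendsto_0)
  have big: "Q.P.prob (A j) \<ge> 1 - r" if "levy_concentration M (a j) \<epsilon> < r" "j \<in> S" for j
  proof -
    let ?E = "{x\<in>space (\<nu> j \<Otimes>\<^sub>M \<nu> j). \<epsilon> \<le> \<bar>fst x - snd x\<bar>}"
    have E: "?E \<in> sets (\<nu> j \<Otimes>\<^sub>M \<nu> j)" by measurable
    have "A j = {z\<in>space ?Q. z j \<in> ?E}"
      using that by (auto simp: A_def space_PiM PiE_iff)
    then have "Q.P.prob (A j) = measure (\<nu> j \<Otimes>\<^sub>M \<nu> j) ?E"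
      using Q.emeasure_PiM_Collect_single[OF UNIV_I E] by (simp add: measure_def)
    also have "\<dots> \<ge> 1 - levy_concentration M (a j) \<epsilon>"
      unfolding \<nu>_def by (rule measure_pair_dist_ge[OF rv])
    finally show ?thesis using that by simp
  qed
  have "eventually (\<lambda>j. Q.P.prob (A j) < 1 - r) sequentially"
    using lim r(2) by (intro order_tendstoD) auto
  then have "finite {j. \<not> Q.P.prob (A j) < 1 - r}"
    by (simp add: eventually_cofinite flip: cofinite_eq_sequentially)
  moreover have "{j. levy_concentration M (a j) \<epsilon> < r \<and> j mod m = k} \<subseteq> {j. \<not> Q.P.prob (A j) < 1 - r}"
    using big by (auto simp: S_def not_less)
  ultimately show False using k finite_subset by blast
qed

text \<open>Markov's inequality at the threshold \<open>(real j + 1)\<^sup>2\<close> gives summable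
  probabilities, and the first Borel-Cantelli lemma concludes.\<close>

lemma (in prob_space) AE_poly_growth:
  fixes a :: "nat \<Rightarrow> 'a \<Rightarrow> real"
  assumes int[measurable]: "\<And>j. integrable M (a j)"
    and \<gamma>: "\<And>j. expectation (\<lambda>\<omega>. \<bar>a j \<omega>\<bar>) \<le> \<gamma>"
  shows "AE \<omega> in M. poly_growth (\<lambda>j. complex_of_real (a j \<omega>))"
proof -
  let ?A = "\<lambda>j. {\<omega>\<in>space M. \<bar>a j \<omega>\<bar> \<ge> (real j + 1)\<^sup>2}"
  have [measurable]: "random_variable borel (a j)" for j using int[of j] by auto
  have "summable (\<lambda>j. prob (?A j))"
  proof (rule summable_comparison_test'[where N=0])
    show "summable (\<lambda>j. \<gamma> * (1 / (real (Suc j))\<^sup>2))"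
      using inverse_squares_sums by (intro summable_mult) (auto simp: sums_iff add.commute)
    fix j
    have "prob (?A j) \<le> expectation (\<lambda>\<omega>. \<bar>a j \<omega>\<bar>) / (real j + 1)\<^sup>2"
      by (rule integral_Markov_inequality_measure[where A="{}"]) (use int[of j] in auto)
    also have "\<dots> \<le> \<gamma> * (1 / (real (Suc j))\<^sup>2)"
      using \<gamma>[of j] by (auto intro!: divide_right_mono simp: add.commute)
    finally show "norm (prob (?A j)) \<le> \<gamma> * (1 / (real (Suc j))\<^sup>2)" by simp
  qed
  then have "AE \<omega> in M. eventually (\<lambda>j. \<omega> \<in> space M - ?A j) sequentially"
    by (intro borel_cantelli_AE1) (auto simp: emeasure_eq_measure)
  then show ?thesis
  proof eventually_elim
    case (elim \<omega>)
    then have "eventually (\<lambda>j. norm (complex_of_real (a j \<omega>)) \<le> (real j + 1)\<^sup>2) sequentially"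
      by eventually_elim auto
    then show ?case by (rule eventually_le_imp_poly_growth)
  qed
qed

lemma natural_boundary_of_not_continuable:
  assumes c: "poly_growth c"
    and not: "\<And>\<theta> \<rho>. \<theta> \<in> \<rat> \<Longrightarrow> \<rho> \<in> \<rat> \<Longrightarrow> \<rho> > 1 / 2 \<Longrightarrow> \<not> continuable c (cis \<theta> / 2) \<rho>"
  shows "natural_boundary c 1"
proof -
  have ext: "\<not> extends_through c 1 (circle_arc 1 \<alpha> \<beta>)" if "\<alpha> < \<beta>" for \<alpha> \<beta>
    using extends_through_imp_continuable[OF c that] not by blast
  have "conv_radius c \<ge> 1"
    by (rule conv_radius_geI_ex') (use poly_growth_summable[OF c] in auto)
  moreover have "conv_radius c \<le> 1"
  proof (rule ccontr)
    assume "\<not> conv_radius c \<le> 1"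
    \<comment> \<open>The series itself would then be holomorphic on \<open>ball 0 R\<close> and
      extend through every arc; the arc from 0 to 1 serves as an instance.\<close>
    then obtain R where R: "1 < R" "ereal R < conv_radius c"
      using ereal_dense2[of 1 "conv_radius c"] by (auto simp: not_le one_ereal_def)
    have "(\<lambda>z. \<Sum>j. c j * z ^ j) holomorphic_on ball 0 R"
    proof (rule power_series_holomorphic[where a=c])
      fix z :: complex assume "z \<in> ball 0 R"
      then have "ereal (norm z) < conv_radius c"
        using R(2) by (auto intro: less_trans[of _ "ereal R"])
      then show "(\<lambda>j. c j * (z - 0) ^ j) sums (\<Sum>j. c j * z ^ j)"
        using summable_sums[OF summable_in_conv_radius] by simp
    qed
    moreover have "ball 0 1 \<union> ball 0 R = ball (0::complex) R" using R(1) by auto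
    moreover have "circle_arc 1 0 1 \<subseteq> ball 0 R" using R(1) by (auto simp: circle_arc_def)
    ultimately have "extends_through c 1 (circle_arc 1 0 1)"
      unfolding extends_through_def
      by (intro exI[of _ "ball 0 R"] exI[of _ "\<lambda>z. \<Sum>j. c j * z ^ j"]) simp
    then show False using ext[of 0 1] by simp
  qed
  ultimately show ?thesis
    using ext unfolding natural_boundary_def by (auto simp: one_ereal_def)
qed

theorem theorem4p2:
  fixes M :: "'w measure" and a :: "nat \<Rightarrow> 'w \<Rightarrow> real" and \<gamma> \<epsilon> :: real
  assumes "prob_space M"
    and "prob_space.indep_vars M (\<lambda>_. borel) a UNIV"
    and "\<And>j. integrable M (a j)"
    and "\<And>j. prob_space.expectation M (\<lambda>\<omega>. \<bar>a j \<omega>\<bar>) \<le> \<gamma>"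
    and "\<epsilon> > 0"
    and "liminf (\<lambda>j. ereal (levy_concentration M (a j) \<epsilon>)) < 1"
  shows "(AE \<omega> in M. conv_radius (\<lambda>j. complex_of_real (a j \<omega>)) = 1) \<and>
         (AE \<omega> in M. natural_boundary (\<lambda>j. complex_of_real (a j \<omega>)) 1)"
proof -
  interpret prob_space M by fact
  let ?c = "\<lambda>\<omega> j. complex_of_real (a j \<omega>)"
  have meas: "{\<omega>\<in>space M. continuable (?c \<omega>) w \<rho>} \<in> events" for w \<rho>
    using borel_measurable_integrable[OF assms(3)] by (intro sets_continuable) measurable
  have "AE \<omega> in M. \<not> continuable (?c \<omega>) (cis \<theta> / 2) \<rho>" if "\<rho> > 1 / 2" for \<theta> \<rho>
    using prob_continuable_eq_0[OF assms(2) that assms(5,6), of \<theta>] meas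
    by (subst (asm) prob_Collect_eq_0) auto
  \<comment> \<open>Rational angles and radii make this a countable intersection of almost sure
    events.\<close>
  then have "AE \<omega> in M. \<forall>\<theta>\<in>\<rat>. \<forall>\<rho>\<in>\<rat> \<inter> {1 / 2<..}. \<not> continuable (?c \<omega>) (cis \<theta> / 2) \<rho>"
    by (subst AE_ball_countable) (auto simp: AE_ball_countable countable_rat)
  moreover have "AE \<omega> in M. poly_growth (?c \<omega>)"
    using AE_poly_growth[OF assms(3,4)] .
  ultimately have nb: "AE \<omega> in M. natural_boundary (?c \<omega>) 1"
  proof eventually_elim
    case (elim \<omega>)
    then show ?case by (intro natural_boundary_of_not_continuable) auto
  qed
  then have "AE \<omega> in M. conv_radius (?c \<omega>) = 1"
    by eventually_elim (simp add: natural_boundary_def one_ereal_def)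
  with nb show ?thesis by blast
qed

end
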